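(* The $\mathbf{Ord}$-monads $\mathsf{F}_1$ of proper filters, $\mathsf{F}_\omega$ of prime filters and $\mathsf{F}_\Omega$ of completely prime filters on the $\mathbf{Ord}$-category $\mathbf{Top}_0$ of $T_0$ topological spaces are lax idempotent and simple.
   Context: An $\mathbf{Ord}$-category is a locally small category whose hom-sets are posets and whose composition is monotone in each variable; an $\mathbf{Ord}$-monad is a monad whose functor part is monotone on hom-posets; it is lax idempotent if $T\eta\le\eta T$. Each $T_0$ space $X$ is ordered by $x\le y$ iff $y\in\overline{\{x\}}$ (the opposite of the specialisation order), and $\mathbf{Top}_0$ is an $\mathbf{Ord}$-category with $f\le g$ iff $f(x)\le g(x)$ for all $x$. The comma-object $f\downarrow g$ of $f\colon X\to Z\leftarrow Y\colon g$ in $\mathbf{Top}_0$ is the subspace $\{(x,y):f(x)\le g(y)\}$ of $X\times Y$. The filter monad $\mathsf{F}=(F,\eta,\mu)$: $FX$ is the set of all filters of open sets of $X$, with topology generated by the sets $U^{\#}=\{\varphi\in FX:U\in\varphi\}$, $U$ open in $X$; $Ff(\varphi)=\{V\in\mathcal{O}(Y):f^{-1}(V)\in\varphi\}$; $\eta_X(x)=\{U\in\mathcal{O}(X):x\in U\}$; $\mu_X(\Theta)=\{U\in\mathcal{O}(X):U^{\#}\in\Theta\}$. $F_1X$, $F_\omega X$, $F_\Omega X$ are the subspaces of $FX$ consisting respectively of the proper filters ($\emptyset\notin\varphi$), the prime filters (proper, and $U\cup V\in\varphi$ implies $U\in\varphi$ or $V\in\varphi$) and the completely prime filters ($\bigcup_iU_i\in\varphi$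 implies some $U_i\in\varphi$); these are the functor parts of submonads $\mathsf{F}_1,\mathsf{F}_\omega,\mathsf{F}_\Omega$ of $\mathsf{F}$, with structure obtained by restriction. For an $\mathbf{Ord}$-monad $\mathsf{T}=(T,\eta,\mu)$ and $f\colon X\to Y$, let $Kf=Tf\downarrow\eta_Y$ be the comma-object of $Tf\colon TX\to TY$ and $\eta_Y\colon Y\to TY$, with projections $q_f\colon Kf\to TX$, $Rf\colon Kf\to Y$, and $Lf\colon X\to Kf$ the unique morphism with $q_f\cdot Lf=\eta_X$, $Rf\cdot Lf=f$. $\mathsf{T}$ is simple if for every $f\colon X\to Y$ the inequality $T(Lf)\cdot\mu_X\cdot Tq_f\le1_{TKf}$ holds (equivalently, the adjunction $F^{\mathsf T}Lf\dashv\varepsilon_{F^{\mathsf T}X}\cdot F^{\mathsf T}q_f$ holds in $\mathsf{T}\text{-Alg}$, where $F^{\mathsf{T}}$ is the free algebra functor and $\varepsilon$ the counit of the free algebra adjunction). *)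

theory Defs
  imports "HOL-Analysis.Analysis"
begin

section \<open>The Ord-category of T0 spaces\<close>

text \<open>Objects are the topologies satisfying \<^const>\<open>t0_space\<close>, over arbitrary HOL types. Morphisms are
  continuous maps, represented by HOL functions that matter only on the \<^const>\<open>topspace\<close> of the source.\<close>

definition top_le :: "'a topology \<Rightarrow> 'a \<Rightarrow> 'a \<Rightarrow> bool" where
  "top_le X x y \<longleftrightarrow> x \<in> topspace X \<and> y \<in> X closure_of {x}"

definition hom_le :: "'a topology \<Rightarrow> 'b topology \<Rightarrow> ('a \<Rightarrow> 'b) \<Rightarrow> ('a \<Rightarrow> 'b) \<Rightarrow> bool" where
  "hom_le X Y f g \<longleftrightarrow>
     continuous_map X Y f \<and> continuous_map X Y g \<and> (\<forall>x\<in>topspace X. top_le Y (f x) (g x))"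

definition hom_eq :: "'a topology \<Rightarrow> 'b topology \<Rightarrow> ('a \<Rightarrow> 'b) \<Rightarrow> ('a \<Rightarrow> 'b) \<Rightarrow> bool" where
  "hom_eq X Y f g \<longleftrightarrow>
     continuous_map X Y f \<and> continuous_map X Y g \<and> (\<forall>x\<in>topspace X. f x = g x)"

lemma top_le_iff:
  "top_le X x y \<longleftrightarrow>
     x \<in> topspace X \<and> y \<in> topspace X \<and> (\<forall>U. openin X U \<and> y \<in> U \<longrightarrow> x \<in> U)"
  by (auto simp: top_le_def in_closure_of)

lemma hom_le_refl: "continuous_map X Y f \<Longrightarrow> hom_le X Y f f"
  by (auto simp: hom_le_def top_le_iff continuous_map_def)

lemma hom_le_trans: "hom_le X Y f g \<Longrightarrow> hom_le X Y g h \<Longrightarrow> hom_le X Y f h"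
  by (auto simp: hom_le_def top_le_iff)

lemma hom_le_antisym:
  assumes "t0_space Y" "hom_le X Y f g" "hom_le X Y g f"
  shows "hom_eq X Y f g"
  using assms unfolding hom_le_def hom_eq_def top_le_iff t0_space_def by metis

lemma hom_le_comp:
  assumes "hom_le X Y f f'" "hom_le Y Z g g'"
  shows "hom_le X Z (g \<circ> f) (g' \<circ> f')"
proof -
  have cf: "continuous_map X Y f" "continuous_map X Y f'"
    and cg: "continuous_map Y Z g" "continuous_map Y Z g'"
    using assms by (auto simp: hom_le_def)
  have "top_le Z (g (f x)) (g' (f' x))" if x: "x \<in> topspace X" for x
  proof -
    have fx: "top_le Y (f x) (f' x)" using assms(1) x by (auto simp: hom_le_def)
    then have gx: "top_le Z (g (f' x)) (g' (f' x))"
      using assms(2) by (auto simp: hom_le_def top_le_iff)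
    have "g (f x) \<in> U" if U: "openin Z U" "g (f' x) \<in> U" for U
    proof -
      have "openin Y {y \<in> topspace Y. g y \<in> U}"
        using cg(1) U(1) by (rule openin_continuous_map_preimage)
      then show ?thesis using fx U(2) by (auto simp: top_le_iff)
    qed
    moreover have "g (f x) \<in> topspace Z"
      using fx cg(1) by (auto simp: top_le_iff continuous_map_def)
    ultimately show ?thesis using gx by (auto simp: top_le_iff)
  qed
  then show ?thesis
    using cf cg by (auto simp: hom_le_def intro: continuous_map_compose)
qed

definition comma_space ::
  "'a topology \<Rightarrow> 'b topology \<Rightarrow> 'c topology \<Rightarrow> ('a \<Rightarrow> 'c) \<Rightarrow> ('b \<Rightarrow> 'c) \<Rightarrow> ('a \<times> 'b) topology" where
  "comma_space X Y Z f g = subtopology (prod_topology X Y) {(x, y). top_le Z (f x) (g y)}"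


section \<open>The filter monad\<close>

text \<open>The improper filter of all open sets is included.\<close>

definition open_filter :: "'a topology \<Rightarrow> 'a set set \<Rightarrow> bool" where
  "open_filter X \<phi> \<longleftrightarrow>
     \<phi> \<subseteq> {U. openin X U} \<and> topspace X \<in> \<phi> \<and>
     (\<forall>U\<in>\<phi>. \<forall>V\<in>\<phi>. U \<inter> V \<in> \<phi>) \<and>
     (\<forall>U\<in>\<phi>. \<forall>V. openin X V \<and> U \<subseteq> V \<longrightarrow> V \<in> \<phi>)"

definition sharp :: "'a topology \<Rightarrow> 'a set \<Rightarrow> 'a set set set" where
  "sharp X U = {\<phi>. open_filter X \<phi> \<and> U \<in> \<phi>}"

text \<open>Every open filter lies in \<^term>\<open>sharp X (topspace X)\<close>, so the carrier of the following space is
  the set of all open filters.\<close>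

definition filter_space :: "'a topology \<Rightarrow> 'a set set topology" where
  "filter_space X = topology_generated_by (sharp X ` {U. openin X U})"

lemma topspace_filter_space: "topspace (filter_space X) = {\<phi>. open_filter X \<phi>}"
  by (auto simp: filter_space_def sharp_def open_filter_def)

definition filter_map ::
  "'a topology \<Rightarrow> 'b topology \<Rightarrow> ('a \<Rightarrow> 'b) \<Rightarrow> 'a set set \<Rightarrow> 'b set set" where
  "filter_map X Y f \<phi> = {V. openin Y V \<and> {x \<in> topspace X. f x \<in> V} \<in> \<phi>}"

definition filter_unit :: "'a topology \<Rightarrow> 'a \<Rightarrow> 'a set set" where
  "filter_unit X x = {U. openin X U \<and> x \<in> U}"

definition filter_mult :: "'a topology \<Rightarrow> 'a set set set set \<Rightarrow> 'a set set" where
  "filter_mult X \<Theta> = {U. openin X U \<and> sharp X U \<in> \<Theta>}"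


section \<open>The submonads of proper, prime and completely prime filters\<close>

datatype filter_kind = Proper | Prime | Completely_Prime

text \<open>A completely prime filter is proper: take the empty family.\<close>

fun of_kind :: "filter_kind \<Rightarrow> 'a topology \<Rightarrow> 'a set set \<Rightarrow> bool" where
  "of_kind Proper X \<phi> \<longleftrightarrow> {} \<notin> \<phi>"
| "of_kind Prime X \<phi> \<longleftrightarrow>
     {} \<notin> \<phi> \<and>
     (\<forall>U V. openin X U \<and> openin X V \<and> U \<union> V \<in> \<phi> \<longrightarrow> U \<in> \<phi> \<or> V \<in> \<phi>)"
| "of_kind Completely_Prime X \<phi> \<longleftrightarrow>
     (\<forall>\<U>. (\<forall>U\<in>\<U>. openin X U) \<and> \<Union>\<U> \<in> \<phi> \<longrightarrow> (\<exists>U\<in>\<U>. U \<in> \<phi>))"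

definition kfilter_space :: "filter_kind \<Rightarrow> 'a topology \<Rightarrow> 'a set set topology" where
  "kfilter_space k X = subtopology (filter_space X) {\<phi>. of_kind k X \<phi>}"

text \<open>Morphism part and unit are restrictions of \<^const>\<open>filter_map\<close> and \<^const>\<open>filter_unit\<close>.
  For the multiplication, a filter on the subspace \<open>T X\<close> of \<open>F X\<close> is first pushed forward
  along the inclusion \<open>T X \<rightarrow> F X\<close>.\<close>

definition kfilter_mult :: "filter_kind \<Rightarrow> 'a topology \<Rightarrow> 'a set set set set \<Rightarrow> 'a set set" where
  "kfilter_mult k X \<Theta> =
     filter_mult X (filter_map (kfilter_space k X) (filter_space X) (\<lambda>\<phi>. \<phi>) \<Theta>)"


section \<open>Ord-monads, lax idempotency and simplicity\<close>

text \<open>A formula cannot quantify over types, so the types carrying the spaces are passed as arguments;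
  a theorem with distinct type variables in these places covers all spaces over all types.
  Every instance of \<^const>\<open>hom_le\<close> and \<^const>\<open>hom_eq\<close> includes the claim that both sides are morphisms.\<close>

definition kfilter_Ord_functor ::
  "filter_kind \<Rightarrow> 'a itself \<Rightarrow> 'b itself \<Rightarrow> 'c itself \<Rightarrow> bool" where
  "kfilter_Ord_functor k _ _ _ \<longleftrightarrow>
     (\<forall>X :: 'a topology. t0_space X \<longrightarrow> t0_space (kfilter_space k X)) \<and>
     (\<forall>(X :: 'a topology) (Y :: 'b topology) f.
        t0_space X \<and> t0_space Y \<and> continuous_map X Y f \<longrightarrow>
        continuous_map (kfilter_space k X) (kfilter_space k Y) (filter_map X Y f)) \<and>
     (\<forall>X :: 'a topology. t0_space X \<longrightarrow>
        hom_eq (kfilter_space k X) (kfilter_space k X) (filter_map X X id) id) \<and>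
     (\<forall>(X :: 'a topology) (Y :: 'b topology) (Z :: 'c topology) f g.
        t0_space X \<and> t0_space Y \<and> t0_space Z \<and> continuous_map X Y f \<and> continuous_map Y Z g \<longrightarrow>
        hom_eq (kfilter_space k X) (kfilter_space k Z)
          (filter_map X Z (g \<circ> f)) (filter_map Y Z g \<circ> filter_map X Y f)) \<and>
     (\<forall>(X :: 'a topology) (Y :: 'b topology) f g.
        t0_space X \<and> t0_space Y \<and> hom_le X Y f g \<longrightarrow>
        hom_le (kfilter_space k X) (kfilter_space k Y) (filter_map X Y f) (filter_map X Y g))"

definition kfilter_unit_natural :: "filter_kind \<Rightarrow> 'a itself \<Rightarrow> 'b itself \<Rightarrow> bool" where
  "kfilter_unit_natural k _ _ \<longleftrightarrow>
     (\<forall>X :: 'a topology. t0_space X \<longrightarrow> continuous_map X (kfilter_space k X) (filter_unit X)) \<and>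
     (\<forall>(X :: 'a topology) (Y :: 'b topology) f.
        t0_space X \<and> t0_space Y \<and> continuous_map X Y f \<longrightarrow>
        hom_eq X (kfilter_space k Y) (filter_unit Y \<circ> f) (filter_map X Y f \<circ> filter_unit X))"

definition kfilter_mult_natural :: "filter_kind \<Rightarrow> 'a itself \<Rightarrow> 'b itself \<Rightarrow> bool" where
  "kfilter_mult_natural k _ _ \<longleftrightarrow>
     (\<forall>X :: 'a topology. t0_space X \<longrightarrow>
        continuous_map (kfilter_space k (kfilter_space k X)) (kfilter_space k X) (kfilter_mult k X)) \<and>
     (\<forall>(X :: 'a topology) (Y :: 'b topology) f.
        t0_space X \<and> t0_space Y \<and> continuous_map X Y f \<longrightarrow>
        hom_eq (kfilter_space k (kfilter_space k X)) (kfilter_space k Y)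
          (kfilter_mult k Y \<circ> filter_map (kfilter_space k X) (kfilter_space k Y) (filter_map X Y f))
          (filter_map X Y f \<circ> kfilter_mult k X))"

definition kfilter_monad_laws :: "filter_kind \<Rightarrow> 'a itself \<Rightarrow> bool" where
  "kfilter_monad_laws k _ \<longleftrightarrow>
     (\<forall>X :: 'a topology. t0_space X \<longrightarrow>
        (let T = kfilter_space k X; TT = kfilter_space k T; TTT = kfilter_space k TT in
          hom_eq T T (kfilter_mult k X \<circ> filter_unit T) id \<and>
          hom_eq T T (kfilter_mult k X \<circ> filter_map X T (filter_unit X)) id \<and>
          hom_eq TTT T (kfilter_mult k X \<circ> kfilter_mult k T)
            (kfilter_mult k X \<circ> filter_map TT T (kfilter_mult k X))))"

definition kfilter_Ord_monad ::
  "filter_kind \<Rightarrow> 'a itself \<Rightarrow> 'b itself \<Rightarrow> 'c itself \<Rightarrow> bool" where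
  "kfilter_Ord_monad k A B C \<longleftrightarrow>
     kfilter_Ord_functor k A B C \<and> kfilter_unit_natural k A B \<and>
     kfilter_mult_natural k A B \<and> kfilter_monad_laws k A"

definition kfilter_lax_idempotent :: "filter_kind \<Rightarrow> 'a itself \<Rightarrow> bool" where
  "kfilter_lax_idempotent k _ \<longleftrightarrow>
     (\<forall>X :: 'a topology. t0_space X \<longrightarrow>
        hom_le (kfilter_space k X) (kfilter_space k (kfilter_space k X))
          (filter_map X (kfilter_space k X) (filter_unit X)) (filter_unit (kfilter_space k X)))"

text \<open>The projections of the comma object \<open>K f\<close> are \<^const>\<open>fst\<close> and \<^const>\<open>snd\<close>, so the morphism
  \<open>L f\<close> induced by the unit and \<open>f\<close> is necessarily given by pairing.\<close>

definition K_space ::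
  "filter_kind \<Rightarrow> 'a topology \<Rightarrow> 'b topology \<Rightarrow> ('a \<Rightarrow> 'b) \<Rightarrow> ('a set set \<times> 'b) topology" where
  "K_space k X Y f =
     comma_space (kfilter_space k X) Y (kfilter_space k Y) (filter_map X Y f) (filter_unit Y)"

definition L_map :: "'a topology \<Rightarrow> ('a \<Rightarrow> 'b) \<Rightarrow> 'a \<Rightarrow> 'a set set \<times> 'b" where
  "L_map X f x = (filter_unit X x, f x)"

definition kfilter_simple :: "filter_kind \<Rightarrow> 'a itself \<Rightarrow> 'b itself \<Rightarrow> bool" where
  "kfilter_simple k _ _ \<longleftrightarrow>
     (\<forall>(X :: 'a topology) (Y :: 'b topology) f.
        t0_space X \<and> t0_space Y \<and> continuous_map X Y f \<longrightarrow>
        (let K = K_space k X Y f; T = kfilter_space k X; TK = kfilter_space k K in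
          t0_space K \<and>
          continuous_map X K (L_map X f) \<and>
          hom_le TK TK (filter_map X K (L_map X f) \<circ> kfilter_mult k X \<circ> filter_map K T fst) id))"

end

(* The sets "all filters of the given kind that contain U", for U open, form a base of the filter
   space, and the order of a filter space is reverse inclusion.  Both inequalities then come down to
   inclusions of basic open sets.  For simplicity, let W be open in K f and U its preimage under L f.
   If (phi, y) lies in W, choose a basic rectangle, given by opens A and B, with (phi, y) in it and
   its trace on K f inside W.  As F f phi <= eta y means that the preimage of B under f belongs
   to phi, the intersection of A with this preimage belongs to phi; it is contained in U, so U
   belongs to phi. *)
theory Submission
  imports Defs
begin

section \<open>The topology of the filter spaces\<close>

text \<open>The trace of U^# on the subspace of filters of kind \<open>k\<close>. Membership in the
  carrier is built in, so that preimages taken within \<open>topspace\<close> are literally sets of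
  this form.\<close>

definition ksharp :: "filter_kind \<Rightarrow> 'a topology \<Rightarrow> 'a set \<Rightarrow> 'a set set set" where
  "ksharp k X U = {\<phi> \<in> topspace (kfilter_space k X). U \<in> \<phi>}"

lemma topspace_kfilter_space:
  "topspace (kfilter_space k X) = {\<phi>. open_filter X \<phi> \<and> of_kind k X \<phi>}"
  by (auto simp: kfilter_space_def topspace_filter_space)

lemma open_filterD:
  assumes "open_filter X \<phi>"
  shows "U \<in> \<phi> \<Longrightarrow> openin X U" "topspace X \<in> \<phi>" "U \<in> \<phi> \<Longrightarrow> V \<in> \<phi> \<Longrightarrow> U \<inter> V \<in> \<phi>"
    "U \<in> \<phi> \<Longrightarrow> openin X V \<Longrightarrow> U \<subseteq> V \<Longrightarrow> V \<in> \<phi>"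
  using assms unfolding open_filter_def by (blast, simp_all)

lemma kfilterD:
  assumes "\<phi> \<in> topspace (kfilter_space k X)"
  shows "U \<in> \<phi> \<Longrightarrow> openin X U" "topspace X \<in> \<phi>" "U \<in> \<phi> \<Longrightarrow> V \<in> \<phi> \<Longrightarrow> U \<inter> V \<in> \<phi>"
    "U \<in> \<phi> \<Longrightarrow> openin X V \<Longrightarrow> U \<subseteq> V \<Longrightarrow> V \<in> \<phi>"
proof -
  have "open_filter X \<phi>" using assms by (simp add: topspace_kfilter_space)
  note \<phi> = open_filterD[OF this]
  show "U \<in> \<phi> \<Longrightarrow> openin X U" "topspace X \<in> \<phi>"
    "U \<in> \<phi> \<Longrightarrow> V \<in> \<phi> \<Longrightarrow> U \<inter> V \<in> \<phi>"
    "U \<in> \<phi> \<Longrightarrow> openin X V \<Longrightarrow> U \<subseteq> V \<Longrightarrow> V \<in> \<phi>"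
    by (fact \<phi>)+
qed

section \<open>The sets U^# as a base of the spaces of filters\<close>

lemma openin_sharp: "openin X U \<Longrightarrow> openin (filter_space X) (sharp X U)"
  unfolding filter_space_def by (rule topology_generated_by_Basis) simp

lemma ksharp_eq_sharp: "ksharp k X U = topspace (kfilter_space k X) \<inter> sharp X U"
  by (auto simp: ksharp_def sharp_def topspace_kfilter_space)

lemma openin_ksharp:
  assumes "openin X U"
  shows "openin (kfilter_space k X) (ksharp k X U)"
proof -
  have "ksharp k X U = sharp X U \<inter> {\<phi>. of_kind k X \<phi>}"
    by (auto simp: ksharp_eq_sharp topspace_kfilter_space sharp_def)
  then show ?thesis
    unfolding kfilter_space_def using openin_sharp[OF assms] by (auto simp: openin_subtopology)
qed

lemma ksharp_mono: "openin X V \<Longrightarrow> U \<subseteq> V \<Longrightarrow> ksharp k X U \<subseteq> ksharp k X V"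
  using kfilterD(4) by (auto simp: ksharp_def)

text \<open>By definition the sets \<open>sharp X U\<close> merely generate the topology. Binary
  intersections lead to nothing new: a filter containing U and V contains their intersection, and by
  upward closure \<open>sharp X (U \<inter> V)\<close> lies in both \<open>sharp X U\<close> and
  \<open>sharp X V\<close>.\<close>

lemma filter_space_basis:
  assumes "openin (filter_space X) W" "\<phi> \<in> W"
  shows "\<exists>U. U \<in> \<phi> \<and> sharp X U \<subseteq> W"
proof -
  have "generate_topology_on (sharp X ` {U. openin X U}) W"
    using assms(1) by (simp add: filter_space_def openin_topology_generated_by_iff)
  then show ?thesis using assms(2)
  proof (induction arbitrary: \<phi>)
    case Empty
    then show ?case by simp
  next
    case (Int a b)
    from Int.IH(1)[of \<phi>] Int.prems obtain U where U: "U \<in> \<phi>" "sharp X U \<subseteq> a" by auto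
    from Int.IH(2)[of \<phi>] Int.prems obtain V where V: "V \<in> \<phi>" "sharp X V \<subseteq> b" by auto
    \<comment> \<open>The induction ranges over arbitrary sets of sets, so that \<phi> is a filter
      has to be recovered from its lying in an open set.\<close>
    have op: "openin (filter_space X) a"
      using Int.hyps by (simp add: filter_space_def openin_topology_generated_by_iff)
    have \<phi>: "open_filter X \<phi>"
      using openin_subset[OF op] Int.prems by (auto simp: topspace_filter_space)
    have "U \<inter> V \<in> \<phi>" using open_filterD(3)[OF \<phi> U(1) V(1)] .
    moreover have "sharp X (U \<inter> V) \<subseteq> sharp X U" "sharp X (U \<inter> V) \<subseteq> sharp X V"
      using open_filterD(1)[OF \<phi> U(1)] open_filterD(1)[OF \<phi> V(1)]
      by (auto simp: sharp_def intro: open_filterD(4)[where U = "U \<inter> V"])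
    ultimately show ?case using U V by blast
  next
    case (UN K)
    then show ?case by (meson Union_iff Union_upper order_trans)
  next
    case (Basis s)
    then show ?case by (auto simp: sharp_def)
  qed
qed

lemma kfilter_space_basis:
  assumes "openin (kfilter_space k X) W" "\<phi> \<in> W"
  obtains U where "openin X U" "U \<in> \<phi>" "ksharp k X U \<subseteq> W"
proof -
  from assms(1) obtain S where S: "openin (filter_space X) S" "W = S \<inter> {\<phi>. of_kind k X \<phi>}"
    by (auto simp: kfilter_space_def openin_subtopology)
  with assms(2) filter_space_basis obtain U where U: "U \<in> \<phi>" "sharp X U \<subseteq> S" by blast
  have "\<phi> \<in> topspace (kfilter_space k X)" using openin_subset[OF assms(1)] assms(2) by blast
  then have "openin X U" using U(1) by (rule kfilterD)
  moreover have "ksharp k X U \<subseteq> W"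
    using U(2) S(2) by (auto simp: ksharp_eq_sharp topspace_kfilter_space)
  ultimately show thesis using that U(1) by blast
qed

section \<open>Continuity, order and separation, tested on the base\<close>

lemma continuous_map_kfilter_space:
  assumes "\<And>x. x \<in> topspace X \<Longrightarrow> g x \<in> topspace (kfilter_space k Y)"
    and "\<And>U. openin Y U \<Longrightarrow> openin X {x \<in> topspace X. U \<in> g x}"
  shows "continuous_map X (kfilter_space k Y) g"
  unfolding continuous_map_def
proof (intro conjI allI impI)
  show "g \<in> topspace X \<rightarrow> topspace (kfilter_space k Y)" using assms(1) by blast
  fix W assume W: "openin (kfilter_space k Y) W"
  \<comment> \<open>Every point of the preimage has an open neighbourhood inside it: choose a basic
    set around \<open>g x\<close> within W; its preimage is open by the second assumption.\<close>
  show "openin X {x \<in> topspace X. g x \<in> W}"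
  proof (subst openin_subopen, intro ballI)
    fix x assume x: "x \<in> {x \<in> topspace X. g x \<in> W}"
    then obtain U where U: "openin Y U" "U \<in> g x" "ksharp k Y U \<subseteq> W"
      using kfilter_space_basis[OF W] by blast
    have "{x \<in> topspace X. U \<in> g x} \<subseteq> {x \<in> topspace X. g x \<in> W}"
      using U(3) assms(1) by (auto simp: ksharp_def)
    then show "\<exists>T. openin X T \<and> x \<in> T \<and> T \<subseteq> {x \<in> topspace X. g x \<in> W}"
      using assms(2)[OF U(1)] x U(2) by blast
  qed
qed

text \<open>Being below \<psi> means lying in every open set that contains \<psi>. On the basic sets
  given by members of \<psi> this is reverse inclusion, and testing these suffices. Inequalities
  between maps into filter spaces thereby become inclusions of filters.\<close>

lemma top_le_kfilter_space:
  "top_le (kfilter_space k X) \<phi> \<psi> \<longleftrightarrow>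
     \<phi> \<in> topspace (kfilter_space k X) \<and> \<psi> \<in> topspace (kfilter_space k X) \<and> \<psi> \<subseteq> \<phi>"
proof -
  have "\<psi> \<subseteq> \<phi>" if "top_le (kfilter_space k X) \<phi> \<psi>"
  proof
    fix U assume "U \<in> \<psi>"
    then have "openin (kfilter_space k X) (ksharp k X U)" "\<psi> \<in> ksharp k X U"
      using that by (auto simp: top_le_iff ksharp_def intro: openin_ksharp[unfolded ksharp_def] kfilterD(1))
    then show "U \<in> \<phi>" using that by (auto simp: top_le_iff ksharp_def)
  qed
  moreover have "\<phi> \<in> W"
    if "\<phi> \<in> topspace (kfilter_space k X)" "\<psi> \<subseteq> \<phi>"
      and W: "openin (kfilter_space k X) W" "\<psi> \<in> W" for W
  proof -
    obtain U where "U \<in> \<psi>" "ksharp k X U \<subseteq> W" using kfilter_space_basis[OF W] by blast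
    then show ?thesis using that by (auto simp: ksharp_def)
  qed
  ultimately show ?thesis by (auto simp: top_le_iff)
qed

lemma t0_space_kfilter_space: "t0_space (kfilter_space k X)"
  unfolding t0_space_def
proof (intro ballI impI)
  fix \<phi> \<psi>
  assume \<phi>: "\<phi> \<in> topspace (kfilter_space k X)" and \<psi>: "\<psi> \<in> topspace (kfilter_space k X)"
    and "\<phi> \<noteq> \<psi>"
  then obtain U where U: "U \<in> \<phi> \<longleftrightarrow> U \<notin> \<psi>" by blast
  then have "openin X U" using kfilterD(1)[OF \<phi>] kfilterD(1)[OF \<psi>] by blast
  moreover have "\<phi> \<in> ksharp k X U \<longleftrightarrow> \<psi> \<notin> ksharp k X U"
    using U \<phi> \<psi> by (simp add: ksharp_def)
  ultimately show "\<exists>W. openin (kfilter_space k X) W \<and> (\<phi> \<notin> W \<longleftrightarrow> \<psi> \<in> W)"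
    by (intro exI[of _ "ksharp k X U"]) (simp add: openin_ksharp)
qed


section \<open>The structure maps\<close>

lemma mem_filter_map:
  "V \<in> filter_map X Y f \<phi> \<longleftrightarrow> openin Y V \<and> {x \<in> topspace X. f x \<in> V} \<in> \<phi>"
  by (simp add: filter_map_def)

lemma mem_filter_unit: "U \<in> filter_unit X x \<longleftrightarrow> openin X U \<and> x \<in> U"
  by (simp add: filter_unit_def)

text \<open>Removes the detour through the full filter space: the preimage of
  \<open>sharp X U\<close> under the inclusion is \<open>ksharp k X U\<close>, so the multiplication
  has the same formula as in the full filter monad.\<close>

lemma mem_kfilter_mult:
  "U \<in> kfilter_mult k X \<Theta> \<longleftrightarrow> openin X U \<and> ksharp k X U \<in> \<Theta>"
proof -
  have "{\<phi> \<in> topspace (kfilter_space k X). \<phi> \<in> sharp X U} = ksharp k X U"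
    by (auto simp: ksharp_eq_sharp)
  then show ?thesis
    by (auto simp: kfilter_mult_def filter_mult_def filter_map_def openin_sharp)
qed

section \<open>The structure maps take values in filters of the given kind\<close>

lemma open_filterI:
  assumes "\<And>U. U \<in> \<phi> \<Longrightarrow> openin X U" "topspace X \<in> \<phi>"
    "\<And>U V. U \<in> \<phi> \<Longrightarrow> V \<in> \<phi> \<Longrightarrow> U \<inter> V \<in> \<phi>"
    "\<And>U V. U \<in> \<phi> \<Longrightarrow> openin X V \<Longrightarrow> U \<subseteq> V \<Longrightarrow> V \<in> \<phi>"
  shows "open_filter X \<phi>"
  unfolding open_filter_def
  by (intro conjI subsetI ballI allI impI CollectI; (elim conjE)?; (rule assms; assumption))

lemma of_kind_Completely_Prime_empty: "of_kind Completely_Prime X \<phi> \<Longrightarrow> {} \<notin> \<phi>"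
  by (auto dest: spec[of _ "{}"])

(* The common form of filter_map and kfilter_mult: a filter is pulled back along a map h of open
   sets that preserves the joins relevant to the kind k. *)
lemma kfilter_vimage:
  assumes \<phi>: "\<phi> \<in> topspace (kfilter_space k X)"
    and op: "\<And>V. openin Y V \<Longrightarrow> openin X (h V)"
    and top: "h (topspace Y) = topspace X"
    and Int: "\<And>U V. openin Y U \<Longrightarrow> openin Y V \<Longrightarrow> h (U \<inter> V) = h U \<inter> h V"
    and empty: "h {} = {}"
    and Un: "\<And>U V. k = Prime \<Longrightarrow> openin Y U \<Longrightarrow> openin Y V \<Longrightarrow> h (U \<union> V) = h U \<union> h V"
    and Union: "\<And>\<U>. k = Completely_Prime \<Longrightarrow> \<forall>U\<in>\<U>. openin Y U \<Longrightarrow> h (\<Union>\<U>) = \<Union>(h ` \<U>)"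
  shows "{V. openin Y V \<and> h V \<in> \<phi>} \<in> topspace (kfilter_space k Y)"
proof -
  have mono: "h U \<subseteq> h V" if "openin Y U" "openin Y V" "U \<subseteq> V" for U V
    using Int[OF that(1,2)] that(3) by (auto simp: Int_absorb2)
  have "open_filter Y {V. openin Y V \<and> h V \<in> \<phi>}"
    by (rule open_filterI)
      (auto simp: top Int intro: kfilterD(2)[OF \<phi>] kfilterD(3)[OF \<phi>] kfilterD(4)[OF \<phi> _ op mono])
  moreover have "of_kind k Y {V. openin Y V \<and> h V \<in> \<phi>}"
  proof (cases k)
    case Proper
    then show ?thesis using \<phi> empty by (auto simp: topspace_kfilter_space)
  next
    case Prime
    have "h U \<in> \<phi> \<or> h V \<in> \<phi>" if "openin Y U" "openin Y V" "h (U \<union> V) \<in> \<phi>" for U V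
      using \<phi> Prime that op[OF that(1)] op[OF that(2)] Un[OF Prime that(1,2)]
      by (simp add: topspace_kfilter_space)
    moreover have "{} \<notin> \<phi>" using \<phi> Prime by (simp add: topspace_kfilter_space)
    ultimately show ?thesis by (auto simp: Prime empty)
  next
    case Completely_Prime
    have "\<exists>U\<in>\<U>. openin Y U \<and> h U \<in> \<phi>" if \<U>: "\<forall>U\<in>\<U>. openin Y U" "h (\<Union>\<U>) \<in> \<phi>" for \<U>
    proof -
      have "\<forall>U\<in>h ` \<U>. openin X U" "\<Union>(h ` \<U>) \<in> \<phi>"
        using \<U> op Union[OF Completely_Prime \<U>(1)] by auto
      then have "\<exists>U\<in>h ` \<U>. U \<in> \<phi>"
        using \<phi> Completely_Prime by (simp only: topspace_kfilter_space mem_Collect_eq of_kind.simps)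
      then show ?thesis using \<U>(1) by blast
    qed
    then show ?thesis using Completely_Prime by simp
  qed
  ultimately show ?thesis by (simp add: topspace_kfilter_space)
qed

text \<open>An instance of \<open>kfilter_vimage\<close>: taking preimages under f preserves
  openness, finite intersections and all unions.\<close>

lemma filter_map_in_kfilter_space:
  assumes "continuous_map X Y f" "\<phi> \<in> topspace (kfilter_space k X)"
  shows "filter_map X Y f \<phi> \<in> topspace (kfilter_space k Y)"
  unfolding filter_map_def
  by (rule kfilter_vimage[OF assms(2)])
    (use assms(1) in \<open>auto simp: continuous_map_def\<close>)

text \<open>A point of a union lies in some member of the family, and no point lies in the empty
  set; this settles all three kinds.\<close>

lemma filter_unit_in_kfilter_space:
  assumes "x \<in> topspace X"
  shows "filter_unit X x \<in> topspace (kfilter_space k X)"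
proof -
  have "open_filter X (filter_unit X x)"
    by (rule open_filterI) (use assms in \<open>auto simp: filter_unit_def\<close>)
  moreover have "of_kind k X (filter_unit X x)"
    by (cases k) (auto simp: filter_unit_def)
  ultimately show ?thesis by (simp add: topspace_kfilter_space)
qed

text \<open>An instance of \<open>kfilter_vimage\<close> with \<open>ksharp k X\<close> as the map
  of open sets. It preserves the empty set because filters of each kind are proper, binary unions by
  primeness and arbitrary unions by complete primeness. This is why \<open>kfilter_vimage\<close>
  asks for each join condition under the matching kind only.\<close>

lemma kfilter_mult_in_kfilter_space:
  assumes "\<Theta> \<in> topspace (kfilter_space k (kfilter_space k X))"
  shows "kfilter_mult k X \<Theta> \<in> topspace (kfilter_space k X)"
proof -
  have eq: "kfilter_mult k X \<Theta> = {U. openin X U \<and> ksharp k X U \<in> \<Theta>}"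
    using mem_kfilter_mult by blast
  have ne: "{} \<notin> \<phi>" if "\<phi> \<in> topspace (kfilter_space k X)" for \<phi>
    using that of_kind_Completely_Prime_empty[of X \<phi>]
    by (cases k) (auto simp: topspace_kfilter_space)
  show ?thesis
    unfolding eq
  proof (rule kfilter_vimage[OF assms])
    show "ksharp k X (topspace X) = topspace (kfilter_space k X)"
      using kfilterD(2) by (auto simp: ksharp_def)
    show "ksharp k X {} = {}" using ne by (auto simp: ksharp_def)
  next
    fix U V assume "openin X U" "openin X V"
    then have "ksharp k X (U \<inter> V) \<subseteq> ksharp k X U" "ksharp k X (U \<inter> V) \<subseteq> ksharp k X V"
      by (auto intro: ksharp_mono[THEN subsetD])
    moreover have "ksharp k X U \<inter> ksharp k X V \<subseteq> ksharp k X (U \<inter> V)"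
      by (auto simp: ksharp_def kfilterD(3))
    ultimately show "ksharp k X (U \<inter> V) = ksharp k X U \<inter> ksharp k X V" by blast
  next
    fix U V assume UV: "k = Prime" "openin X U" "openin X V"
    show "ksharp k X (U \<union> V) = ksharp k X U \<union> ksharp k X V"
    proof
      show "ksharp k X (U \<union> V) \<subseteq> ksharp k X U \<union> ksharp k X V"
        using UV by (auto simp: ksharp_def topspace_kfilter_space)
      show "ksharp k X U \<union> ksharp k X V \<subseteq> ksharp k X (U \<union> V)"
        using UV by (intro Un_least ksharp_mono) auto
    qed
  next
    fix \<U> assume k: "k = Completely_Prime" and \<U>: "\<forall>U\<in>\<U>. openin X U"
    show "ksharp k X (\<Union>\<U>) = \<Union>(ksharp k X ` \<U>)"
    proof
      show "ksharp k X (\<Union>\<U>) \<subseteq> \<Union>(ksharp k X ` \<U>)"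
        using k \<U> by (auto simp: ksharp_def topspace_kfilter_space)
      show "\<Union>(ksharp k X ` \<U>) \<subseteq> ksharp k X (\<Union>\<U>)"
        using \<U> by (intro UN_least ksharp_mono openin_Union) auto
    qed
  qed (rule openin_ksharp)
qed

section \<open>Continuity of the structure maps\<close>

lemma continuous_map_filter_map:
  assumes "continuous_map X Y f"
  shows "continuous_map (kfilter_space k X) (kfilter_space k Y) (filter_map X Y f)"
proof (rule continuous_map_kfilter_space)
  fix V assume V: "openin Y V"
  then have "{\<phi> \<in> topspace (kfilter_space k X). V \<in> filter_map X Y f \<phi>} =
      ksharp k X {x \<in> topspace X. f x \<in> V}"
    by (auto simp: ksharp_def mem_filter_map)
  then show "openin (kfilter_space k X) {\<phi> \<in> topspace (kfilter_space k X). V \<in> filter_map X Y f \<phi>}"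
    using openin_ksharp openin_continuous_map_preimage[OF assms V] by metis
qed (rule filter_map_in_kfilter_space[OF assms])

text \<open>The key fact about the unit: it yields one of the unit laws, and in lax idempotency and
  simplicity it sends the points of U into a basic neighbourhood given by U.\<close>

lemma filter_unit_vimage_ksharp:
  "openin X U \<Longrightarrow> {x \<in> topspace X. filter_unit X x \<in> ksharp k X U} = U"
  using openin_subset filter_unit_in_kfilter_space
  by (fastforce simp: ksharp_def mem_filter_unit)

lemma continuous_map_filter_unit: "continuous_map X (kfilter_space k X) (filter_unit X)"
proof (rule continuous_map_kfilter_space)
  fix U assume U: "openin X U"
  then have "{x \<in> topspace X. U \<in> filter_unit X x} = U"
    using openin_subset by (fastforce simp: mem_filter_unit)
  then show "openin X {x \<in> topspace X. U \<in> filter_unit X x}" using U by simp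
qed (rule filter_unit_in_kfilter_space)

lemma continuous_map_kfilter_mult:
  "continuous_map (kfilter_space k (kfilter_space k X)) (kfilter_space k X) (kfilter_mult k X)"
proof (rule continuous_map_kfilter_space)
  fix U assume U: "openin X U"
  then have "{\<Theta> \<in> topspace (kfilter_space k (kfilter_space k X)). U \<in> kfilter_mult k X \<Theta>} =
      ksharp k (kfilter_space k X) (ksharp k X U)"
    by (auto simp: ksharp_def[of k "kfilter_space k X"] mem_kfilter_mult)
  then show "openin (kfilter_space k (kfilter_space k X))
      {\<Theta> \<in> topspace (kfilter_space k (kfilter_space k X)). U \<in> kfilter_mult k X \<Theta>}"
    by (simp add: openin_ksharp U)
qed (rule kfilter_mult_in_kfilter_space)


section \<open>The monad and its properties\<close>

lemma hom_eqI:
  assumes "continuous_map X Y f" "continuous_map X Y g" "\<And>x. x \<in> topspace X \<Longrightarrow> f x = g x"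
  shows "hom_eq X Y f g"
  using assms by (simp add: hom_eq_def)

lemma filter_map_id:
  assumes "\<phi> \<in> topspace (kfilter_space k X)"
  shows "filter_map X X id \<phi> = \<phi>"
proof -
  have "{x \<in> topspace X. x \<in> V} = V" if "openin X V" for V
    using openin_subset[OF that] by blast
  then show ?thesis using kfilterD(1)[OF assms] by (auto simp: mem_filter_map)
qed

lemma filter_map_comp:
  assumes "continuous_map X Y f" "continuous_map Y Z g"
  shows "filter_map X Z (g \<circ> f) \<phi> = filter_map Y Z g (filter_map X Y f \<phi>)"
proof -
  \<comment> \<open>Preimages are formed within carriers, so the iterated preimage carries the extra
    condition \<open>f x \<in> topspace Y\<close>, which continuity of f makes automatic.\<close>
  have "{x \<in> topspace X. f x \<in> topspace Y \<and> g (f x) \<in> V} = {x \<in> topspace X. g (f x) \<in> V}" for V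
    using assms(1) by (auto simp: continuous_map_def)
  moreover have "openin Y {y \<in> topspace Y. g y \<in> V}" if "openin Z V" for V
    using assms(2) that by (rule openin_continuous_map_preimage)
  ultimately show ?thesis by (auto simp: mem_filter_map)
qed

lemma hom_le_filter_map:
  assumes "hom_le X Y f g"
  shows "hom_le (kfilter_space k X) (kfilter_space k Y) (filter_map X Y f) (filter_map X Y g)"
proof -
  have f: "continuous_map X Y f" and g: "continuous_map X Y g"
    using assms by (auto simp: hom_le_def)
  have "filter_map X Y g \<phi> \<subseteq> filter_map X Y f \<phi>" if \<phi>: "\<phi> \<in> topspace (kfilter_space k X)" for \<phi>
  proof
    fix V assume "V \<in> filter_map X Y g \<phi>"
    then have V: "openin Y V" "{x \<in> topspace X. g x \<in> V} \<in> \<phi>" by (auto simp: mem_filter_map)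
    \<comment> \<open>In the opposite of the specialisation order, an open set containing
      \<open>g x\<close> also contains the smaller point \<open>f x\<close>.\<close>
    have "{x \<in> topspace X. g x \<in> V} \<subseteq> {x \<in> topspace X. f x \<in> V}"
      using assms V(1) by (auto simp: hom_le_def top_le_iff)
    then show "V \<in> filter_map X Y f \<phi>"
      using kfilterD(4)[OF \<phi> V(2)] openin_continuous_map_preimage[OF f V(1)] V(1)
      by (auto simp: mem_filter_map)
  qed
  then show ?thesis
    unfolding hom_le_def top_le_kfilter_space
    by (simp add: continuous_map_filter_map f g filter_map_in_kfilter_space)
qed

lemma kfilter_Ord_functor: "kfilter_Ord_functor k TYPE('a) TYPE('b) TYPE('c)"
  unfolding kfilter_Ord_functor_def
proof (intro conjI allI impI; (elim conjE)?)
  fix X :: "'a topology"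
  have "continuous_map (kfilter_space k X) (kfilter_space k X) (filter_map X X id)"
    by (intro continuous_map_filter_map continuous_map_id)
  then show "hom_eq (kfilter_space k X) (kfilter_space k X) (filter_map X X id) id"
    by (rule hom_eqI) (auto simp: filter_map_id)
next
  fix X :: "'a topology" and Y :: "'b topology" and Z :: "'c topology" and f g
  assume f: "continuous_map X Y f" and g: "continuous_map Y Z g"
  show "hom_eq (kfilter_space k X) (kfilter_space k Z)
      (filter_map X Z (g \<circ> f)) (filter_map Y Z g \<circ> filter_map X Y f)"
    by (intro hom_eqI continuous_map_compose[OF continuous_map_filter_map] continuous_map_filter_map
        continuous_map_compose[OF f] f g)
      (simp add: filter_map_comp[OF f g])
qed (simp_all add: t0_space_kfilter_space continuous_map_filter_map hom_le_filter_map)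

section \<open>Naturality, monad laws and lax idempotency\<close>

lemma kfilter_unit_natural: "kfilter_unit_natural k TYPE('a) TYPE('b)"
  unfolding kfilter_unit_natural_def
proof (intro conjI allI impI; (elim conjE)?)
  fix X :: "'a topology" and Y :: "'b topology" and f
  assume f: "continuous_map X Y f"
  show "hom_eq X (kfilter_space k Y) (filter_unit Y \<circ> f) (filter_map X Y f \<circ> filter_unit X)"
  proof (rule hom_eqI)
    fix x assume "x \<in> topspace X"
    then show "(filter_unit Y \<circ> f) x = (filter_map X Y f \<circ> filter_unit X) x"
      using openin_continuous_map_preimage[OF f]
      by (auto simp: mem_filter_map mem_filter_unit)
  next
    show "continuous_map X (kfilter_space k Y) (filter_unit Y \<circ> f)"
      using f continuous_map_filter_unit by (rule continuous_map_compose)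
    show "continuous_map X (kfilter_space k Y) (filter_map X Y f \<circ> filter_unit X)"
      using continuous_map_filter_unit continuous_map_filter_map[OF f] by (rule continuous_map_compose)
  qed
qed (rule continuous_map_filter_unit)

lemma kfilter_mult_natural: "kfilter_mult_natural k TYPE('a) TYPE('b)"
  unfolding kfilter_mult_natural_def
proof (intro conjI allI impI; (elim conjE)?)
  fix X :: "'a topology" and Y :: "'b topology" and f
  assume f: "continuous_map X Y f"
  let ?TX = "kfilter_space k X" and ?TY = "kfilter_space k Y"
  show "hom_eq (kfilter_space k ?TX) ?TY
      (kfilter_mult k Y \<circ> filter_map ?TX ?TY (filter_map X Y f))
      (filter_map X Y f \<circ> kfilter_mult k X)"
  proof (rule hom_eqI)
    fix \<Theta>
    \<comment> \<open>The operation # commutes with preimages along f; read through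
      \<open>mem_kfilter_mult\<close>, this is naturality of the multiplication.\<close>
    have "{\<phi> \<in> topspace ?TX. filter_map X Y f \<phi> \<in> ksharp k Y V} =
        ksharp k X {x \<in> topspace X. f x \<in> V}" if "openin Y V" for V
      using that filter_map_in_kfilter_space[OF f] by (auto simp: ksharp_def mem_filter_map)
    then show "(kfilter_mult k Y \<circ> filter_map ?TX ?TY (filter_map X Y f)) \<Theta> =
        (filter_map X Y f \<circ> kfilter_mult k X) \<Theta>"
      using openin_continuous_map_preimage[OF f]
      by (auto simp: mem_filter_map mem_kfilter_mult openin_ksharp)
  next
    show "continuous_map (kfilter_space k ?TX) ?TY
        (kfilter_mult k Y \<circ> filter_map ?TX ?TY (filter_map X Y f))"
      using continuous_map_filter_map[OF continuous_map_filter_map[OF f]] continuous_map_kfilter_mult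
      by (rule continuous_map_compose)
    show "continuous_map (kfilter_space k ?TX) ?TY (filter_map X Y f \<circ> kfilter_mult k X)"
      using continuous_map_kfilter_mult continuous_map_filter_map[OF f] by (rule continuous_map_compose)
  qed
qed (rule continuous_map_kfilter_mult)

text \<open>Each law is checked on open sets U by computing a preimage of U^#: along the unit it is
  U, along the multiplication it is U^##. The first unit law only uses that \<phi> lies in U^#
  exactly when U belongs to \<phi>.\<close>

lemma kfilter_monad_laws: "kfilter_monad_laws k TYPE('a)"
  unfolding kfilter_monad_laws_def Let_def
proof (intro conjI allI impI)
  fix X :: "'a topology"
  let ?T = "kfilter_space k X"
  let ?TT = "kfilter_space k ?T"
  let ?TTT = "kfilter_space k ?TT"
  show "hom_eq ?T ?T (kfilter_mult k X \<circ> filter_unit ?T) id"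
  proof (rule hom_eqI)
    fix \<phi> assume \<phi>: "\<phi> \<in> topspace ?T"
    then have "\<phi> \<in> ksharp k X U \<longleftrightarrow> U \<in> \<phi>" for U by (simp add: ksharp_def)
    then show "(kfilter_mult k X \<circ> filter_unit ?T) \<phi> = id \<phi>"
      using kfilterD(1)[OF \<phi>] by (auto simp: mem_kfilter_mult mem_filter_unit openin_ksharp)
  qed (intro continuous_map_compose[OF continuous_map_filter_unit[of _ k]]
      continuous_map_kfilter_mult continuous_map_id)+
  show "hom_eq ?T ?T (kfilter_mult k X \<circ> filter_map X ?T (filter_unit X)) id"
  proof (rule hom_eqI)
    fix \<phi> assume \<phi>: "\<phi> \<in> topspace ?T"
    show "(kfilter_mult k X \<circ> filter_map X ?T (filter_unit X)) \<phi> = id \<phi>"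
      using kfilterD(1)[OF \<phi>]
      by (auto simp: mem_kfilter_mult mem_filter_map openin_ksharp filter_unit_vimage_ksharp)
  qed (intro continuous_map_compose[OF continuous_map_filter_map]
      continuous_map_filter_unit continuous_map_kfilter_mult continuous_map_id)+
  show "hom_eq ?TTT ?T (kfilter_mult k X \<circ> kfilter_mult k ?T)
      (kfilter_mult k X \<circ> filter_map ?TT ?T (kfilter_mult k X))"
  proof (rule hom_eqI)
    fix \<Theta>
    \<comment> \<open>Consequently both composites put U into their value exactly when
      \<open>ksharp k ?T (ksharp k X U)\<close> belongs to \<Theta>.\<close>
    have "{\<Xi> \<in> topspace ?TT. kfilter_mult k X \<Xi> \<in> ksharp k X U} = ksharp k ?T (ksharp k X U)"
      if "openin X U" for U
      using that kfilter_mult_in_kfilter_space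
      by (auto simp: ksharp_def[of k ?T] ksharp_def[of k X] mem_kfilter_mult)
    then show "(kfilter_mult k X \<circ> kfilter_mult k ?T) \<Theta> =
        (kfilter_mult k X \<circ> filter_map ?TT ?T (kfilter_mult k X)) \<Theta>"
      by (auto simp: mem_kfilter_mult mem_filter_map openin_ksharp)
  qed (intro continuous_map_compose[OF continuous_map_filter_map]
      continuous_map_compose[OF continuous_map_kfilter_mult] continuous_map_kfilter_mult)+
qed

text \<open>A neighbourhood W of \<phi> contains U^# for some member U of \<phi>. The preimage of
  U^# under the unit is U, so the preimage of W contains U and belongs to \<phi> by upward
  closure.\<close>

lemma kfilter_lax_idempotent: "kfilter_lax_idempotent k TYPE('a)"
  unfolding kfilter_lax_idempotent_def
proof (intro allI impI)
  fix X :: "'a topology"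
  let ?T = "kfilter_space k X"
  have "filter_unit ?T \<phi> \<subseteq> filter_map X ?T (filter_unit X) \<phi>" if \<phi>: "\<phi> \<in> topspace ?T" for \<phi>
  proof
    fix W assume "W \<in> filter_unit ?T \<phi>"
    then have W: "openin ?T W" "\<phi> \<in> W" by (auto simp: mem_filter_unit)
    then obtain U where U: "openin X U" "U \<in> \<phi>" "ksharp k X U \<subseteq> W"
      by (rule kfilter_space_basis)
    have "U \<subseteq> {x \<in> topspace X. filter_unit X x \<in> W}"
      using filter_unit_vimage_ksharp[OF U(1), of k] U(3) by blast
    then show "W \<in> filter_map X ?T (filter_unit X) \<phi>"
      using kfilterD(4)[OF \<phi> U(2)] W(1)
        openin_continuous_map_preimage[OF continuous_map_filter_unit W(1)]
      by (auto simp: mem_filter_map)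
  qed
  then show "hom_le ?T (kfilter_space k ?T) (filter_map X ?T (filter_unit X)) (filter_unit ?T)"
    unfolding hom_le_def top_le_kfilter_space
    by (simp add: continuous_map_filter_map continuous_map_filter_unit
        filter_map_in_kfilter_space filter_unit_in_kfilter_space)
qed

section \<open>The comma object and simplicity\<close>

lemma topspace_K_space:
  assumes "continuous_map X Y f"
  shows "(\<phi>, y) \<in> topspace (K_space k X Y f) \<longleftrightarrow>
    \<phi> \<in> topspace (kfilter_space k X) \<and> y \<in> topspace Y \<and>
    (\<forall>B. openin Y B \<and> y \<in> B \<longrightarrow> {x \<in> topspace X. f x \<in> B} \<in> \<phi>)"
  \<comment> \<open>By \<open>top_le_kfilter_space\<close> the comma condition says that the image
    of \<phi> under f contains every open neighbourhood of y, that is, converges to y.\<close>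
  using filter_map_in_kfilter_space[OF assms] filter_unit_in_kfilter_space
  by (auto simp: K_space_def comma_space_def top_le_kfilter_space mem_filter_map mem_filter_unit)

text \<open>If B is an open neighbourhood of \<open>f x\<close>, its preimage is an open
  neighbourhood of x. By naturality of the unit the comma condition even holds with equality
  here.\<close>

lemma L_map_in_K_space:
  assumes "continuous_map X Y f" "x \<in> topspace X"
  shows "L_map X f x \<in> topspace (K_space k X Y f)"
  using assms openin_continuous_map_preimage[OF assms(1)]
  by (auto simp: L_map_def topspace_K_space mem_filter_unit filter_unit_in_kfilter_space
      continuous_map_def Pi_iff)

lemma continuous_map_L_map:
  assumes "continuous_map X Y f"
  shows "continuous_map X (K_space k X Y f) (L_map X f)"
proof -
  have "continuous_map X (prod_topology (kfilter_space k X) Y) (L_map X f)"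
    unfolding L_map_def
    by (intro continuous_map_pairedI continuous_map_filter_unit assms)
  then show ?thesis
    using L_map_in_K_space[OF assms, of _ k]
    by (auto simp: K_space_def comma_space_def continuous_map_in_subtopology)
qed

lemma continuous_map_K_space_fst:
  "continuous_map (K_space k X Y f) (kfilter_space k X) fst"
  unfolding K_space_def comma_space_def
  by (intro continuous_map_from_subtopology continuous_map_fst)

lemma t0_space_K_space:
  assumes "t0_space Y"
  shows "t0_space (K_space k X Y f)"
  unfolding K_space_def comma_space_def
  by (intro t0_space_subtopology) (simp add: t0_space_prod_topologyI t0_space_kfilter_space assms)

text \<open>Supplies the inclusion behind simplicity: with U the preimage of W under
  \<open>L_map X f\<close>, it places W inside the preimage of \<open>ksharp k X U\<close> under
  \<open>fst\<close>.\<close>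

lemma L_map_vimage_mem_filter:
  assumes f: "continuous_map X Y f" and W: "openin (K_space k X Y f) W" "(\<phi>, y) \<in> W"
  shows "{x \<in> topspace X. L_map X f x \<in> W} \<in> \<phi>"
proof -
  let ?T = "kfilter_space k X"
  have K: "(\<phi>, y) \<in> topspace (K_space k X Y f)" using openin_subset[OF W(1)] W(2) by blast
  then have \<phi>: "\<phi> \<in> topspace ?T" by (simp add: topspace_K_space[OF f])
  \<comment> \<open>Writing W as S cut down to the carrier of the comma object separates two tasks:
    the rectangle controls membership in S, while \<open>L_map_in_K_space\<close> gives membership
    in the carrier.\<close>
  obtain S where S: "openin (prod_topology ?T Y) S" "W = S \<inter> topspace (K_space k X Y f)"
  proof -
    from W(1) obtain S where "openin (prod_topology ?T Y) S"
      "W = S \<inter> {(\<phi>, y). top_le (kfilter_space k Y) (filter_map X Y f \<phi>) (filter_unit Y y)}"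
      by (auto simp: K_space_def comma_space_def openin_subtopology)
    moreover have "S \<subseteq> topspace (prod_topology ?T Y)" using openin_subset calculation(1) .
    ultimately show thesis
      by (intro that[of S]) (auto simp: K_space_def comma_space_def)
  qed
  have "(\<phi>, y) \<in> S" using S(2) W(2) by simp
  with S(1) have "\<exists>V B. openin ?T V \<and> openin Y B \<and> \<phi> \<in> V \<and> y \<in> B \<and> V \<times> B \<subseteq> S"
    by (simp add: openin_prod_topology_alt)
  then obtain V B where VB: "openin ?T V" "openin Y B" "\<phi> \<in> V" "y \<in> B" "V \<times> B \<subseteq> S"
    by (elim exE conjE)
  from VB(1,3) obtain A where A: "openin X A" "A \<in> \<phi>" "ksharp k X A \<subseteq> V"
    by (rule kfilter_space_basis)
  \<comment> \<open>Here the comma condition at \<open>(\<phi>, y)\<close> enters: it turns the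
    second side of the rectangle into a member of \<phi>.\<close>
  have "{x \<in> topspace X. f x \<in> B} \<in> \<phi>" using K VB by (simp add: topspace_K_space[OF f])
  with A(2) have "A \<inter> {x \<in> topspace X. f x \<in> B} \<in> \<phi>" by (rule kfilterD(3)[OF \<phi>])
  moreover have "A \<inter> {x \<in> topspace X. f x \<in> B} \<subseteq> {x \<in> topspace X. L_map X f x \<in> W}"
  proof clarify
    fix x assume x: "x \<in> A" "x \<in> topspace X" "f x \<in> B"
    then have "filter_unit X x \<in> V" using filter_unit_vimage_ksharp[OF A(1), of k] A(3) by blast
    then have "L_map X f x \<in> S" using x VB(5) by (auto simp: L_map_def)
    then show "L_map X f x \<in> W" using S(2) L_map_in_K_space[OF f x(2)] by blast
  qed
  ultimately show ?thesis
    using kfilterD(4)[OF \<phi>] openin_continuous_map_preimage[OF continuous_map_L_map[OF f] W(1)]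
    by blast
qed

text \<open>Since the order is reverse inclusion, the inequality asks that every member W of
  \<Theta> belong to \<open>?g \<Theta>\<close>. Unfolding the three maps, this means that the
  preimage of U^# under \<open>fst\<close> belongs to \<Theta>, where U is the preimage of W under
  \<open>L_map X f\<close>. This preimage is open and contains W, so upward closure of \<Theta>
  applies.\<close>

lemma kfilter_simple: "kfilter_simple k TYPE('a) TYPE('b)"
  unfolding kfilter_simple_def Let_def
proof (intro allI impI, elim conjE, intro conjI)
  fix X :: "'a topology" and Y :: "'b topology" and f
  assume Y: "t0_space Y" and f: "continuous_map X Y f"
  let ?K = "K_space k X Y f" and ?T = "kfilter_space k X"
  let ?TK = "kfilter_space k ?K"
  let ?g = "filter_map X ?K (L_map X f) \<circ> kfilter_mult k X \<circ> filter_map ?K ?T fst"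
  show "t0_space ?K" using Y by (rule t0_space_K_space)
  show "continuous_map X ?K (L_map X f)" using f by (rule continuous_map_L_map)
  have g: "continuous_map ?TK ?TK ?g"
    by (intro continuous_map_compose[OF continuous_map_filter_map]
        continuous_map_compose[OF continuous_map_kfilter_mult]
        continuous_map_filter_map continuous_map_L_map continuous_map_K_space_fst f)
  have "\<Theta> \<subseteq> ?g \<Theta>" if \<Theta>: "\<Theta> \<in> topspace ?TK" for \<Theta>
  proof
    fix W assume W: "W \<in> \<Theta>"
    then have opW: "openin ?K W" by (rule kfilterD(1)[OF \<Theta>])
    define U where "U = {x \<in> topspace X. L_map X f x \<in> W}"
    have U: "openin X U"
      unfolding U_def using continuous_map_L_map[OF f] opW by (rule openin_continuous_map_preimage)
    have sub: "W \<subseteq> {p \<in> topspace ?K. fst p \<in> ksharp k X U}"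
      using openin_subset[OF opW] L_map_vimage_mem_filter[OF f opW]
      by (auto simp: U_def ksharp_def topspace_K_space[OF f])
    have "openin ?K {p \<in> topspace ?K. fst p \<in> ksharp k X U}"
      using continuous_map_K_space_fst openin_ksharp[OF U] by (rule openin_continuous_map_preimage)
    then have "{p \<in> topspace ?K. fst p \<in> ksharp k X U} \<in> \<Theta>"
      using kfilterD(4)[OF \<Theta> W _ sub] by blast
    then show "W \<in> ?g \<Theta>"
      using opW U by (simp add: mem_filter_map mem_kfilter_mult openin_ksharp flip: U_def)
  qed
  then show "hom_le ?TK ?TK ?g id"
    using g continuous_map_image_subset_topspace[OF g]
    unfolding hom_le_def top_le_kfilter_space by auto
qed

theorem corollary13p3:
  fixes k :: filter_kind
  shows "kfilter_Ord_monad k TYPE('a) TYPE('b) TYPE('c) \<and>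
         kfilter_lax_idempotent k TYPE('a) \<and>
         kfilter_simple k TYPE('a) TYPE('b)"
  by (simp add: kfilter_Ord_monad_def kfilter_Ord_functor kfilter_unit_natural
      kfilter_mult_natural kfilter_monad_laws kfilter_lax_idempotent kfilter_simple)

end
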